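(* Any deterministic online algorithm is at least $\Omega(\ln D)$-competitive for scheduling moldable task graphs under an arbitrary speedup model, where $D$ denotes the number of tasks along the longest path of the graph. That is, there exist an absolute constant $c>0$ and an integer $D_0$ such that for every deterministic online algorithm and every integer $D\ge D_0$, there is an instance (a number $P$ of processors and a finite directed acyclic graph of moldable tasks whose longest path has $D$ tasks) on which the makespan $T$ of the algorithm satisfies $T\ge c\,\ln(D)\,T^{\mathrm{opt}}$, where $T^{\mathrm{opt}}$ is the optimal offline makespan.
   Context: Problem. A finite DAG of tasks is to be executed on $P$ identical processors. An edge $(i,j)$ means that task $j$ cannot start before task $i$ is completed. Tasks are moldable: when task $j$ starts, an integer number $p\in\{1,\dots,P\}$ of processors is chosen for it; it then runs without interruption (no preemption, no restart) on exactly $p$ processors for time $t_j(p)$. At any time at most $P$ processors are in use. Online setting: a task becomes available, and its existence and execution time function become known to the algorithm, only when all its predecessors are completed. The makespan is the completion time of the last task; $T^{\mathrm{opt}}$ is the minimum makespan over all feasible (offline) schedules. Arbitrary speedup model: the execution time $t_j(p)>0$ of a task can be an arbitrary function of its processor allocation $p$. *)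

theory Defs
  imports Complex_Main
begin

section \<open>Moldable task graphs\<close>

record problem =
  procs :: nat
  tasks :: "nat set"
  edges :: "(nat \<times> nat) set"
  exec_time :: "nat \<Rightarrow> nat \<Rightarrow> real"

text \<open>Only the values \<open>exec_time I j p\<close> with \<open>j\<close> a task and \<open>1 \<le> p \<le> procs I\<close> are meaningful.\<close>

definition valid_problem :: "problem \<Rightarrow> bool" where
  "valid_problem I \<longleftrightarrow>
     1 \<le> procs I \<and>
     finite (tasks I) \<and> tasks I \<noteq> {} \<and>
     edges I \<subseteq> tasks I \<times> tasks I \<and> acyclic (edges I) \<and>
     (\<forall>j\<in>tasks I. \<forall>p\<in>{1..procs I}. 0 < exec_time I j p)"

definition is_path :: "problem \<Rightarrow> nat list \<Rightarrow> bool" where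
  "is_path I xs \<longleftrightarrow>
     xs \<noteq> [] \<and> set xs \<subseteq> tasks I \<and> successively (\<lambda>i j. (i, j) \<in> edges I) xs"

definition longest_path :: "problem \<Rightarrow> nat" where
  "longest_path I = Max {length xs | xs. is_path I xs}"


section \<open>Schedules\<close>

record schedule =
  start :: "nat \<Rightarrow> real"
  alloc :: "nat \<Rightarrow> nat"

definition completion :: "problem \<Rightarrow> schedule \<Rightarrow> nat \<Rightarrow> real" where
  "completion I S j = start S j + exec_time I j (alloc S j)"

definition feasible :: "problem \<Rightarrow> schedule \<Rightarrow> bool" where
  "feasible I S \<longleftrightarrow>
     (\<forall>j\<in>tasks I. 0 \<le> start S j \<and> alloc S j \<in> {1..procs I}) \<and>
     (\<forall>(i, j)\<in>edges I. completion I S i \<le> start S j) \<and>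
     (\<forall>\<tau>. (\<Sum>j\<in>{j \<in> tasks I. start S j \<le> \<tau> \<and> \<tau> < completion I S j}. alloc S j) \<le> procs I)"

definition makespan :: "problem \<Rightarrow> schedule \<Rightarrow> real" where
  "makespan I S = Max (completion I S ` tasks I)"

text \<open>
  The infimum is attained: for each of the finitely many allocations, the admissible start times
  below any given bound form a compact set.
\<close>

definition opt_makespan :: "problem \<Rightarrow> real" where
  "opt_makespan I = Inf {makespan I S | S. feasible I S}"


section \<open>Deterministic online algorithms\<close>

text \<open>
  What an online algorithm can observe at time \<open>\<tau>\<close>: the tasks all of whose predecessors are
  completed by time \<open>\<tau>\<close>, the edges between these tasks, their execution time functions, and the
  start times and allocations that were fixed strictly before \<open>\<tau>\<close>.
\<close>

record view =
  known_tasks :: "nat set"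
  known_edges :: "(nat \<times> nat) set"
  known_exec :: "nat \<Rightarrow> (nat \<Rightarrow> real) option"
  past_starts :: "nat \<Rightarrow> (real \<times> nat) option"

definition available :: "problem \<Rightarrow> schedule \<Rightarrow> real \<Rightarrow> nat set" where
  "available I S \<tau> = {j \<in> tasks I. \<forall>i. (i, j) \<in> edges I \<longrightarrow> completion I S i \<le> \<tau>}"

definition view_at :: "problem \<Rightarrow> schedule \<Rightarrow> real \<Rightarrow> view" where
  "view_at I S \<tau> =
     \<lparr> known_tasks = available I S \<tau>,
       known_edges = edges I \<inter> available I S \<tau> \<times> available I S \<tau>,
       known_exec = (\<lambda>j. if j \<in> available I S \<tau> then Some (exec_time I j) else None),
       past_starts = (\<lambda>j. if j \<in> tasks I \<and> start S j < \<tau> then Some (start S j, alloc S j) else None) \<rparr>"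

text \<open>
  A policy receives the number of processors, the current time and the current view, and returns
  the tasks to be started at exactly this moment, each with its processor allocation. It is
  consulted at every time \<open>\<tau> \<ge> 0\<close>, so that a task may also be started at a moment at which no
  other task is completed.
\<close>

type_synonym policy = "nat \<Rightarrow> real \<Rightarrow> view \<Rightarrow> (nat \<Rightarrow> nat option)"

definition starts_at :: "problem \<Rightarrow> schedule \<Rightarrow> real \<Rightarrow> (nat \<Rightarrow> nat option)" where
  "starts_at I S \<tau> = (\<lambda>j. if j \<in> tasks I \<and> start S j = \<tau> then Some (alloc S j) else None)"

definition produces :: "policy \<Rightarrow> problem \<Rightarrow> schedule \<Rightarrow> bool" where
  "produces A I S \<longleftrightarrow>
     feasible I S \<and> (\<forall>\<tau>\<ge>0. starts_at I S \<tau> = A (procs I) \<tau> (view_at I S \<tau>))"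

definition online_algorithm :: "policy \<Rightarrow> bool" where
  "online_algorithm A \<longleftrightarrow> (\<forall>I. valid_problem I \<longrightarrow> (\<exists>S. produces A I S))"

text \<open>A policy determines the schedule of all tasks, hence also the makespan.\<close>

lemma produces_unique:
  assumes I: "valid_problem I" and S: "produces A I S" and S': "produces A I S'"
    and j: "j \<in> tasks I"
  shows "start S j = start S' j \<and> alloc S j = alloc S' j"
proof -
  have same: "start S' i = start S i \<and> alloc S' i = alloc S i"
    if "starts_at I S (start S i) = starts_at I S' (start S i)" "i \<in> tasks I" for i S S'
    using fun_cong[OF that(1), of i] that(2) by (auto simp: starts_at_def split: if_splits)
  have avail: "available I S \<tau> \<subseteq> available I S' \<tau>"
    if S: "produces A I S" and eq: "\<And>\<sigma>. \<sigma> < \<tau> \<Longrightarrow> starts_at I S \<sigma> = starts_at I S' \<sigma>" for S S' \<tau>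
  proof
    fix k assume k: "k \<in> available I S \<tau>"
    have "completion I S' i \<le> \<tau>" if e: "(i, k) \<in> edges I" for i
    proof -
      have i: "i \<in> tasks I" using e I by (auto simp: valid_problem_def)
      have c: "completion I S i \<le> \<tau>" using k e by (auto simp: available_def)
      have "alloc S i \<in> {1..procs I}" using S i by (auto simp: produces_def feasible_def)
      then have "0 < exec_time I i (alloc S i)" using I i by (auto simp: valid_problem_def)
      with c have "start S i < \<tau>" by (simp add: completion_def)
      from same[OF eq[OF this] i] c show ?thesis by (simp add: completion_def)
    qed
    with k show "k \<in> available I S' \<tau>" by (auto simp: available_def)
  qed
  have past: "past_starts (view_at I S \<tau>) i = past_starts (view_at I S' \<tau>) i"
    if eq: "\<And>\<sigma>. \<sigma> < \<tau> \<Longrightarrow> starts_at I S \<sigma> = starts_at I S' \<sigma>" for i \<tau>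
  proof (cases "i \<in> tasks I \<and> (start S i < \<tau> \<or> start S' i < \<tau>)")
    case True
    then have "start S' i = start S i \<and> alloc S' i = alloc S i"
      using same[of S i S'] same[of S' i S] eq by metis
    then show ?thesis by (simp add: view_at_def)
  qed (auto simp: view_at_def)
  define B where "B = {\<tau>. starts_at I S \<tau> \<noteq> starts_at I S' \<tau>}"
  have B_sub: "B \<subseteq> start S ` tasks I \<union> start S' ` tasks I"
    by (force simp: B_def starts_at_def fun_eq_iff split: if_splits)
  moreover have "finite (tasks I)" using I by (simp add: valid_problem_def)
  ultimately have fin: "finite B" by (meson finite_UnI finite_imageI finite_subset)
  have "B = {}"
  proof (rule ccontr)
    assume ne: "B \<noteq> {}"
    define \<tau> where "\<tau> = Min B"
    have \<tau>: "\<tau> \<in> B" using Min_in[OF fin ne] by (simp add: \<tau>_def)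
    have eq: "starts_at I S \<sigma> = starts_at I S' \<sigma>" if "\<sigma> < \<tau>" for \<sigma>
      using that Min_le[OF fin, of \<sigma>] by (force simp: B_def \<tau>_def)
    have "0 \<le> \<tau>" using \<tau> B_sub S S' by (auto simp: produces_def feasible_def)
    moreover have "available I S \<tau> = available I S' \<tau>"
      using avail[OF S eq] avail[OF S' eq[symmetric]] by blast
    then have "view_at I S \<tau> = view_at I S' \<tau>"
      using past[OF eq] by (simp add: view_at_def fun_eq_iff)
    ultimately have "starts_at I S \<tau> = starts_at I S' \<tau>"
      using S S' by (simp add: produces_def)
    with \<tau> show False by (simp add: B_def)
  qed
  then have "starts_at I S (start S j) = starts_at I S' (start S j)" by (auto simp: B_def)
  from same[OF this j] show ?thesis by simp
qed

end

theory Submission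
  imports "HOL-Analysis.Henstock_Kurzweil_Integration" "HOL-Library.Nat_Bijection"
    "HOL-Library.Discrete_Functions" "HOL-Combinatorics.Transposition" Defs
begin

text \<open>
  The instance consists of \<open>2 ^ K - 1\<close> disjoint chains, \<open>2 ^ (K - m)\<close> of them with \<open>m\<close> tasks for
  \<open>m = 1, \<dots>, K\<close>, all tasks having execution time \<open>1 / (\<lfloor>log\<^sub>2 p\<rfloor> + 1)\<close>. Giving \<open>2 ^ (m - 1)\<close>
  processors to each chain of length \<open>m\<close> uses \<open>K * 2 ^ (K - 1) \<le> P\<close> processors, where
  \<open>P = 2 ^ (L + K - 1)\<close> and \<open>K \<le> 2 ^ L\<close>, and finishes everything at time 1.

  Online, a chain looks like any other one until it ends. The adversary ends chains one at a time:
  as long as the current group \<open>m\<close> is not complete, the chain that is the first of the remaining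
  ones to finish its \<open>m\<close>-th task ends there. Hence no longer chain finishes its \<open>m\<close>-th task before
  all of group \<open>m\<close> is done, and the groups pass one after the other through disjoint time
  intervals. By counting work, the interval of group \<open>m\<close> has length at least \<open>1 / (L + m)\<close>, and
  the sum of these is at least \<open>ln (K / (L + 1))\<close>. Here \<open>L + 1\<close> can be taken as \<open>\<lfloor>sqrt K\<rfloor>\<close>.
\<close>

section \<open>Locality of online policies and the area bound\<close>

text \<open>The instance \<open>I'\<close> is a predecessor-closed part of \<open>I\<close>, and
  each removed task waits for a predecessor completed at \<open>e\<close> or later. Hence a first
  disagreement before \<open>e\<close> would be between two answers of the policy to the same
  view.\<close>

lemma produces_agree:
  assumes I: "valid_problem I" and I': "valid_problem I'"
    and S: "produces A I S" and S': "produces A I' S'"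
    and procs: "procs I' = procs I" and exec: "exec_time I' = exec_time I"
    and tasks: "tasks I' \<subseteq> tasks I" and edges: "edges I' = {(i, j) \<in> edges I. j \<in> tasks I'}"
    and late: "\<And>j. j \<in> tasks I - tasks I' \<Longrightarrow> \<exists>i. (i, j) \<in> edges I \<and> e \<le> completion I S i"
    and \<sigma>: "\<sigma> < e"
  shows "starts_at I S \<sigma> = starts_at I' S' \<sigma>"
proof -
  have start_less: "start T i < \<tau>"
    if "valid_problem J" "produces A J T" "i \<in> tasks J" "completion J T i \<le> \<tau>" for J T i \<tau>
  proof -
    have "alloc T i \<in> {1..procs J}" using that by (auto simp: produces_def feasible_def)
    then have "0 < exec_time J i (alloc T i)" using that by (auto simp: valid_problem_def)
    with that show ?thesis by (simp add: completion_def)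
  qed
  have starts_Some: "starts_at J T \<tau> j = Some p \<longleftrightarrow> j \<in> tasks J \<and> start T j = \<tau> \<and> alloc T j = p"
    for J T \<tau> j p by (auto simp: starts_at_def)
  \<comment> \<open>Disagreements occur only at start times, so there are finitely many and a first
    one can be chosen.\<close>
  define B where "B = {\<tau>. \<tau> < e \<and> starts_at I S \<tau> \<noteq> starts_at I' S' \<tau>}"
  have B_sub: "B \<subseteq> start S ` tasks I \<union> start S' ` tasks I'"
    by (force simp: B_def starts_at_def fun_eq_iff split: if_splits)
  moreover have "finite (tasks I)" "finite (tasks I')" using I I' by (auto simp: valid_problem_def)
  ultimately have fin: "finite B" by (meson finite_UnI finite_imageI finite_subset)
  have "B = {}"
  proof (rule ccontr)
    assume ne: "B \<noteq> {}"
    define \<tau> where "\<tau> = Min B"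
    have \<tau>: "\<tau> \<in> B" using Min_in[OF fin ne] by (simp add: \<tau>_def)
    then have \<tau>e: "\<tau> < e" by (simp add: B_def)
    have eq: "starts_at I S \<sigma> = starts_at I' S' \<sigma>" if "\<sigma> < \<tau>" for \<sigma>
      using that Min_le[OF fin, of \<sigma>] \<tau>e by (force simp: B_def \<tau>_def)
    have same: "j \<in> tasks I' \<and> start S' j = start S j \<and> alloc S' j = alloc S j"
      if "j \<in> tasks I" "start S j < \<tau>" for j
      using eq[OF that(2)] that(1) starts_Some[of I S "start S j" j "alloc S j"]
        starts_Some[of I' S' "start S j" j "alloc S j"] by auto
    have same': "j \<in> tasks I \<and> start S' j = start S j \<and> alloc S' j = alloc S j"
      if "j \<in> tasks I'" "start S' j < \<tau>" for j
      using eq[OF that(2)] that(1) starts_Some[of I S "start S' j" j "alloc S' j"]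
        starts_Some[of I' S' "start S' j" j "alloc S' j"] by auto
    have "0 \<le> \<tau>" using \<tau> B_sub S S' by (auto simp: produces_def feasible_def)
    have sub: "available I S \<tau> \<subseteq> tasks I'"
      using late \<tau>e by (force simp: available_def)
    \<comment> \<open>Since execution times are positive, a predecessor completed by \<tau> has
      started strictly before \<tau>, where both schedules coincide.\<close>
    have avail: "available I S \<tau> = available I' S' \<tau>"
    proof (intro equalityI subsetI)
      fix k assume k: "k \<in> available I S \<tau>"
      have "completion I' S' i \<le> \<tau>" if e: "(i, k) \<in> edges I'" for i
      proof -
        have "(i, k) \<in> edges I" using e edges by auto
        then have c: "completion I S i \<le> \<tau>" and "i \<in> tasks I"
          using k I by (auto simp: available_def valid_problem_def)
        with same[OF _ start_less[OF I S _ c]] show ?thesis by (simp add: completion_def exec)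
      qed
      with k sub show "k \<in> available I' S' \<tau>" by (auto simp: available_def)
    next
      fix k assume k: "k \<in> available I' S' \<tau>"
      have "completion I S i \<le> \<tau>" if e: "(i, k) \<in> edges I" for i
      proof -
        have "(i, k) \<in> edges I'" using e edges k by (auto simp: available_def)
        then have c: "completion I' S' i \<le> \<tau>" and "i \<in> tasks I'"
          using k I' by (auto simp: available_def valid_problem_def)
        with same'[OF _ start_less[OF I' S' _ c]] show ?thesis by (simp add: completion_def exec)
      qed
      with k tasks show "k \<in> available I S \<tau>" by (auto simp: available_def)
    qed
    have "edges I \<inter> available I S \<tau> \<times> available I S \<tau> =
        edges I' \<inter> available I S \<tau> \<times> available I S \<tau>"
      using sub edges by auto
    moreover have "past_starts (view_at I S \<tau>) j = past_starts (view_at I' S' \<tau>) j" for j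
    proof (cases "j \<in> tasks I \<and> start S j < \<tau> \<or> j \<in> tasks I' \<and> start S' j < \<tau>")
      case True
      then have "j \<in> tasks I \<and> j \<in> tasks I' \<and> start S' j = start S j \<and> alloc S' j = alloc S j"
        using same[of j] same'[of j] by blast
      then show ?thesis by (simp add: view_at_def)
    qed (auto simp: view_at_def)
    ultimately have "view_at I S \<tau> = view_at I' S' \<tau>"
      using avail by (simp add: view_at_def fun_eq_iff exec)
    with \<open>0 \<le> \<tau>\<close> have "starts_at I S \<tau> = starts_at I' S' \<tau>"
      using S S' procs by (simp add: produces_def)
    with \<tau> show False by (simp add: B_def)
  qed
  with \<sigma> show ?thesis by (auto simp: B_def)
qed

text \<open>The left side is the integral over \<open>{a..b}\<close> of the number of processors
  used by the tasks in \<open>X\<close>; at every moment this number is at most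
  \<open>procs I\<close>.\<close>

lemma window_area:
  assumes feas: "feasible I S" and fin: "finite (tasks I)" and X: "X \<subseteq> tasks I"
    and ab: "a \<le> b"
    and win: "\<And>j. j \<in> X \<Longrightarrow> a \<le> start S j \<and> start S j \<le> completion I S j \<and> completion I S j \<le> b"
  shows "(\<Sum>j\<in>X. real (alloc S j) * (completion I S j - start S j)) \<le> real (procs I) * (b - a)"
proof -
  have finX: "finite X" using X fin by (rule finite_subset)
  define f where "f j \<tau> = (if start S j \<le> \<tau> \<and> \<tau> < completion I S j then real (alloc S j) else 0)" for j \<tau>
  have f: "(f j has_integral real (alloc S j) * (completion I S j - start S j)) {a..b}"
    if j: "j \<in> X" for j
  proof -
    let ?J = "{start S j..completion I S j}"
    have "((\<lambda>_. real (alloc S j)) has_integral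
        real (alloc S j) * (completion I S j - start S j)) ?J"
      using has_integral_const_real[of "real (alloc S j)" "start S j" "completion I S j"] win[OF j]
      by (simp add: mult.commute)
    then have "((\<lambda>\<tau>. if \<tau> \<in> ?J then real (alloc S j) else 0) has_integral
        real (alloc S j) * (completion I S j - start S j)) {a..b}"
      using win[OF j] by (subst has_integral_restrict) auto
    \<comment> \<open>\<open>f j\<close> differs from the indicator of the closed interval only at
      the completion time, when the task no longer runs.\<close>
    then show ?thesis
      by (rule has_integral_spike_finite[of "{completion I S j}", rotated 2]) (auto simp: f_def)
  qed
  have "((\<lambda>\<tau>. \<Sum>j\<in>X. f j \<tau>) has_integral
      (\<Sum>j\<in>X. real (alloc S j) * (completion I S j - start S j))) {a..b}"
    by (rule has_integral_sum[OF finX f])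
  moreover have "((\<lambda>_. real (procs I)) has_integral real (procs I) * (b - a)) {a..b}"
    using has_integral_const_real[of "real (procs I)" a b] ab by (simp add: mult.commute)
  moreover have "(\<Sum>j\<in>X. f j \<tau>) \<le> real (procs I)" for \<tau>
  proof -
    let ?R = "{j \<in> tasks I. start S j \<le> \<tau> \<and> \<tau> < completion I S j}"
    have "(\<Sum>j\<in>X. f j \<tau>) = (\<Sum>j\<in>X \<inter> ?R. real (alloc S j))"
      using finX X by (auto simp: f_def sum.If_cases intro!: sum.cong)
    also have "\<dots> \<le> (\<Sum>j\<in>?R. real (alloc S j))"
      using fin by (intro sum_mono2) auto
    also have "\<dots> \<le> real (procs I)"
      using feas by (simp add: feasible_def flip: of_nat_sum)
    finally show ?thesis .
  qed
  ultimately show ?thesis by (rule has_integral_le)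
qed


section \<open>Disjoint chains\<close>

abbreviation task :: "nat \<Rightarrow> nat \<Rightarrow> nat" where
  "task c i \<equiv> prod_encode (c, i)"

text \<open>Task numbers and execution times do not depend on \<open>len\<close>, so cutting a chain
  leaves the remaining tasks literally unchanged.\<close>

definition chain_graph :: "nat \<Rightarrow> nat \<Rightarrow> (nat \<Rightarrow> nat) \<Rightarrow> problem" where
  "chain_graph P n len =
     \<lparr> procs = P,
       tasks = {task c i | c i. c \<in> {1..n} \<and> i < len c},
       edges = {(task c i, task c (Suc i)) | c i. c \<in> {1..n} \<and> Suc i < len c},
       exec_time = (\<lambda>j p. 1 / real (Suc (floor_log p))) \<rparr>"

text \<open>Completion time in a chain graph, written without the instance so that schedules of
  differently cut instances can be compared.\<close>

definition finish :: "schedule \<Rightarrow> nat \<Rightarrow> nat \<Rightarrow> real" where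
  "finish S c i = start S (task c i) + 1 / real (Suc (floor_log (alloc S (task c i))))"

lemma chain_graph_simps [simp]:
  "procs (chain_graph P n len) = P"
  "exec_time (chain_graph P n len) j p = 1 / real (Suc (floor_log p))"
  "task c i \<in> tasks (chain_graph P n len) \<longleftrightarrow> c \<in> {1..n} \<and> i < len c"
  "(task c i, task d j) \<in> edges (chain_graph P n len) \<longleftrightarrow>
     d = c \<and> j = Suc i \<and> c \<in> {1..n} \<and> Suc i < len c"
  by (auto simp: chain_graph_def)

lemma completion_chain_graph [simp]: "completion (chain_graph P n len) S (task c i) = finish S c i"
  by (simp add: completion_def finish_def)

lemma start_less_finish: "start S (task c i) < finish S c i"
  by (simp add: finish_def)

lemma tasks_chain_graphE:
  assumes "j \<in> tasks (chain_graph P n len)"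
  obtains c i where "j = task c i" "c \<in> {1..n}" "i < len c"
  using assms by (auto simp: chain_graph_def)

lemma finite_tasks_chain_graph [simp]: "finite (tasks (chain_graph P n len))"
proof -
  have "tasks (chain_graph P n len) = prod_encode ` (SIGMA c:{1..n}. {..<len c})"
    by (auto simp: chain_graph_def)
  then show ?thesis by simp
qed

lemma valid_chain_graph:
  assumes "1 \<le> P" "1 \<le> n" "1 \<le> len 1"
  shows "valid_problem (chain_graph P n len)"
proof -
  have "edges (chain_graph P n len) \<subseteq> Wellfounded.measure (\<lambda>j. snd (prod_decode j))"
    by (auto simp: chain_graph_def)
  then have "acyclic (edges (chain_graph P n len))"
    by (meson acyclic_subset wf_acyclic wf_measure)
  moreover have "task 1 0 \<in> tasks (chain_graph P n len)" using assms by simp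
  ultimately show ?thesis
    using assms finite_tasks_chain_graph[of P n len]
    unfolding valid_problem_def by (auto simp: chain_graph_def)
qed

lemma longest_path_chain_graph:
  assumes c: "c \<in> {1..n}" "len c = K" "1 \<le> K" and le: "\<And>d. d \<in> {1..n} \<Longrightarrow> len d \<le> K"
  shows "longest_path (chain_graph P n len) = K"
  unfolding longest_path_def
proof (rule Max_eqI)
  let ?I = "chain_graph P n len"
  have bound: "i + length xs \<le> len d" if "hd xs = task d i" "is_path ?I xs" for xs d i
    using that
  proof (induction xs arbitrary: i)
    case Nil
    then show ?case by (simp add: is_path_def)
  next
    case (Cons x xs)
    show ?case
    proof (cases xs)
      case Nil
      with Cons.prems show ?thesis by (auto simp: is_path_def)
    next
      case (Cons y ys)
      then have "(task d i, y) \<in> edges ?I" using Cons.prems by (auto simp: is_path_def)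
      then have "y = task d (Suc i)" by (auto simp: chain_graph_def)
      moreover have "is_path ?I xs" using Cons Cons.prems by (auto simp: is_path_def)
      ultimately have "Suc i + length xs \<le> len d" using Cons.IH Cons by auto
      then show ?thesis by simp
    qed
  qed
  show le_K: "y \<le> K" if "y \<in> {length xs |xs. is_path ?I xs}" for y
  proof -
    from that obtain xs where xs: "is_path ?I xs" "y = length xs" by auto
    then have "hd xs \<in> tasks ?I" by (auto simp: is_path_def)
    then obtain d i where "hd xs = task d i" "d \<in> {1..n}" by (auto elim: tasks_chain_graphE)
    with bound[OF this(1) xs(1)] le[of d] xs show ?thesis by simp
  qed
  then show "finite {length xs |xs. is_path ?I xs}"
    by (intro finite_subset[OF _ finite_atMost[of K]]) auto
  have "is_path ?I (map (task c) [0..<K])"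
    using c by (auto simp: is_path_def successively_map successively_conv_nth)
  then show "K \<in> {length xs |xs. is_path ?I xs}"
    by (force intro: exI[of _ "map (task c) [0..<K]"])
qed

text \<open>With \<open>2 ^ (len c - 1)\<close> processors set aside for chain \<open>c\<close>,
  each of its tasks takes time \<open>1 / len c\<close>, so all chains end at time 1.\<close>

lemma opt_makespan_chain_graph:
  assumes P: "(\<Sum>c = 1..n. 2 ^ (len c - 1)) \<le> P" and len: "\<And>c. c \<in> {1..n} \<Longrightarrow> 1 \<le> len c"
    and n: "1 \<le> n"
  shows "opt_makespan (chain_graph P n len) \<le> 1"
proof -
  let ?I = "chain_graph P n len"
  define S where "S = \<lparr> start = (\<lambda>j. case prod_decode j of (c, i) \<Rightarrow> real i / real (len c)),
    alloc = (\<lambda>j. case prod_decode j of (c, i) \<Rightarrow> 2 ^ (len c - 1)) \<rparr>"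
  have start: "start S (task c i) = real i / real (len c)"
    and alloc: "alloc S (task c i) = 2 ^ (len c - 1)" for c i
    by (simp_all add: S_def)
  have fin: "finish S c i = real (Suc i) / real (len c)" if "c \<in> {1..n}" for c i
    using len[OF that] by (simp add: finish_def start alloc add_divide_distrib)
  have task_ne: "tasks ?I \<noteq> {}"
  proof -
    have "task 1 0 \<in> tasks ?I" using n len[of 1] by simp
    then show ?thesis by blast
  qed
  have "feasible ?I S"
    unfolding feasible_def
  proof (intro conjI ballI allI)
    fix j assume "j \<in> tasks ?I"
    then obtain c i where j: "j = task c i" "c \<in> {1..n}" "i < len c" by (rule tasks_chain_graphE)
    show "0 \<le> start S j" by (simp add: j start)
    have "2 ^ (len c - 1) \<le> (\<Sum>c = 1..n. 2 ^ (len c - 1) :: nat)"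
      using j(2) by (intro member_le_sum) auto
    with P show "alloc S j \<in> {1..procs ?I}" by (simp add: j alloc)
  next
    fix x assume "x \<in> edges ?I"
    then obtain c i where x: "x = (task c i, task c (Suc i))" "c \<in> {1..n}"
      by (auto simp: chain_graph_def)
    show "case x of (i, j) \<Rightarrow> completion ?I S i \<le> start S j"
      using x by (simp add: fin start)
  next
    fix \<tau>
    let ?R = "{j \<in> tasks ?I. start S j \<le> \<tau> \<and> \<tau> < completion ?I S j}"
    define ch where "ch j = fst (prod_decode j)" for j
    \<comment> \<open>At most one task of each chain runs at any moment, so the processors in use
      can be summed over chains.\<close>
    have "inj_on ch ?R"
    proof (rule inj_onI)
      fix x y assume x: "x \<in> ?R" and y: "y \<in> ?R" and eq: "ch x = ch y"
      from x obtain c i where xi: "x = task c i" "c \<in> {1..n}" by (auto elim: tasks_chain_graphE)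
      from y eq xi obtain j where yj: "y = task c j" by (auto elim: tasks_chain_graphE simp: ch_def)
      have pos: "0 < real (len c)" using len[OF xi(2)] by simp
      have "real i / real (len c) < real (Suc j) / real (len c)"
        "real j / real (len c) < real (Suc i) / real (len c)"
        using x y xi yj by (auto simp: fin start simp del: of_nat_Suc)
      then have "i < Suc j" "j < Suc i" using pos by (simp_all add: divide_less_cancel)
      then show "x = y" using xi yj by simp
    qed
    then have "(\<Sum>j\<in>?R. alloc S j) = (\<Sum>c\<in>ch ` ?R. 2 ^ (len c - 1))"
      by (subst sum.reindex) (auto simp: ch_def S_def case_prod_beta)
    also have "\<dots> \<le> (\<Sum>c = 1..n. 2 ^ (len c - 1))"
      by (intro sum_mono2) (auto simp: ch_def elim!: tasks_chain_graphE)
    also have "\<dots> \<le> P" by (rule P)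
    finally show "(\<Sum>j\<in>?R. alloc S j) \<le> procs ?I" by simp
  qed
  have "makespan ?I S \<le> 1"
    unfolding makespan_def
  proof (subst Max_le_iff)
    show "\<forall>x\<in>completion ?I S ` tasks ?I. x \<le> 1"
      by (auto elim!: tasks_chain_graphE simp: fin)
  qed (use task_ne in auto)
  moreover have "opt_makespan ?I \<le> makespan ?I S"
    unfolding opt_makespan_def
  proof (rule cInf_lower)
    show "makespan ?I S \<in> {makespan ?I S |S. feasible ?I S}" using \<open>feasible ?I S\<close> by auto
    \<comment> \<open>An infimum of reals is known to lie below the elements only if the set is
      bounded below; 0 is such a bound.\<close>
    have "0 \<le> makespan ?I T" if T: "feasible ?I T" for T
    proof -
      have t: "task 1 0 \<in> tasks ?I" using n len[of 1] by simp
      have "0 \<le> start T (task 1 0)" using T t unfolding feasible_def by blast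
      also have "\<dots> \<le> completion ?I T (task 1 0)" using start_less_finish[of T 1 0] by simp
      also have "\<dots> \<le> makespan ?I T"
        unfolding makespan_def by (rule Max_ge[OF _ imageI[OF t]]) simp
      finally show ?thesis .
    qed
    then show "bdd_below {makespan ?I S |S. feasible ?I S}" by (auto intro!: bdd_belowI[of _ 0])
  qed
  ultimately show ?thesis by simp
qed

section \<open>Cutting chains adaptively\<close>

lemma chain_graph_cong:
  assumes "\<And>c. c \<in> {1..n} \<Longrightarrow> len c = len' c"
  shows "chain_graph P n len = chain_graph P n len'"
proof -
  have "tasks (chain_graph P n len) = tasks (chain_graph P n len')"
    and "edges (chain_graph P n len) = edges (chain_graph P n len')"
    using assms by (auto simp: chain_graph_def)
  then show ?thesis by (simp add: chain_graph_def)
qed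

lemma finish_mono:
  assumes "feasible (chain_graph P n len) S" "c \<in> {1..n}" "i \<le> j" "j < len c"
  shows "finish S c i \<le> finish S c j"
  using assms(3,4)
proof (induction j rule: dec_induct)
  case (step j)
  have "(task c j, task c (Suc j)) \<in> edges (chain_graph P n len)" using assms(2) step by simp
  then have "completion (chain_graph P n len) S (task c j) \<le> start S (task c (Suc j))"
    using assms(1) unfolding feasible_def by blast
  with step start_less_finish[of S c "Suc j"] show ?case by simp
qed simp

text \<open>Until the \<open>m\<close>-th task of chain \<open>c\<close>, at position
  \<open>m - 1\<close>, is completed, the cut chain cannot be told from the uncut one. A task
  finishing at that very moment has started strictly earlier, so \<open>early\<close> may be
  non-strict.\<close>

lemma produces_chain_graph_cut:
  assumes S: "produces A (chain_graph P n len) S" and S': "produces A (chain_graph P n (len(c := m))) S'"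
    and P: "1 \<le> P" and len: "\<And>d. d \<in> {1..n} \<Longrightarrow> 1 \<le> len d"
    and c: "c \<in> {1..n}" and m: "1 \<le> m" "m \<le> len c"
    and t: "d \<in> {1..n}" "i < (len(c := m)) d"
    and early: "finish S d i \<le> finish S c (m - 1) \<or> finish S' d i \<le> finish S c (m - 1)"
  shows "finish S' d i = finish S d i"
proof -
  let ?I = "chain_graph P n len" and ?I' = "chain_graph P n (len(c := m))"
  \<comment> \<open>At the earlier of the two starts both runs still agree, so this start is common
    to them; hence a bound on either finish time suffices.\<close>
  define \<sigma> where "\<sigma> = min (start S (task d i)) (start S' (task d i))"
  have \<sigma>: "\<sigma> < finish S c (m - 1)"
    using early start_less_finish[of S d i] start_less_finish[of S' d i] by (auto simp: \<sigma>_def)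
  have feas: "feasible ?I S" using S by (simp add: produces_def)
  have n: "1 \<le> n" using c by simp
  have "starts_at ?I S \<sigma> = starts_at ?I' S' \<sigma>"
  proof (rule produces_agree[OF _ _ S S' _ _ _ _ _ \<sigma>])
    show "valid_problem ?I" using P n len[of 1] by (intro valid_chain_graph) auto
    show "valid_problem ?I'" using P n len[of 1] m by (intro valid_chain_graph) auto
    show "exec_time ?I' = exec_time ?I" by (simp add: chain_graph_def)
    show "tasks ?I' \<subseteq> tasks ?I" using m by (auto elim!: tasks_chain_graphE split: if_splits)
    show "edges ?I' = {(i, j) \<in> edges ?I. j \<in> tasks ?I'}"
      using m by (auto simp: chain_graph_def split: if_splits)
    fix j assume j: "j \<in> tasks ?I - tasks ?I'"
    then obtain k where k: "j = task c k" "m \<le> k" "k < len c"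
      by (auto elim!: tasks_chain_graphE split: if_splits)
    then have "(task c (k - 1), j) \<in> edges ?I" using c m by simp
    moreover have "finish S c (m - 1) \<le> finish S c (k - 1)"
      using finish_mono[OF feas c] k by simp
    ultimately show "\<exists>i. (i, j) \<in> edges ?I \<and> finish S c (m - 1) \<le> completion ?I S i"
      by (intro exI[of _ "task c (k - 1)"]) simp
  qed simp
  then have "starts_at ?I S \<sigma> (task d i) = starts_at ?I' S' \<sigma> (task d i)" by simp
  moreover have "task d i \<in> tasks ?I" "task d i \<in> tasks ?I'" using t m by (auto split: if_splits)
  moreover have "start S (task d i) = \<sigma> \<or> start S' (task d i) = \<sigma>" by (auto simp: \<sigma>_def)
  ultimately show ?thesis by (auto simp: starts_at_def finish_def split: if_splits)
qed

text \<open>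
  The chains are cut in the order of decreasing rank \<open>\<rho>\<close>; those of rank above \<open>s\<close> have been cut
  already. Cutting a chain can change the schedule only from the end of that chain on, which keeps
  the comparisons obtained earlier.
\<close>

lemma adversary:
  assumes A: "online_algorithm A" and P: "1 \<le> P" and n: "1 \<le> n"
    and h: "\<And>r. r \<in> {1..n} \<Longrightarrow> 1 \<le> h r \<and> h r \<le> K"
    and anti: "\<And>r s. 1 \<le> r \<Longrightarrow> r \<le> s \<Longrightarrow> s \<le> n \<Longrightarrow> h s \<le> h r"
    and s: "s \<le> n"
  shows "\<exists>\<rho> S. bij_betw \<rho> {1..n} {1..n} \<and>
    produces A (chain_graph P n (\<lambda>c. if s < \<rho> c then h (\<rho> c) else K)) S \<and>
    (\<forall>c\<in>{1..n}. \<forall>d\<in>{1..n}. s < \<rho> c \<longrightarrow> \<rho> d < \<rho> c \<longrightarrow>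
       finish S c (h (\<rho> c) - 1) \<le> finish S d (h (\<rho> c) - 1))"
  using s
proof (induction rule: inc_induct)
  case base
  let ?I = "chain_graph P n (\<lambda>c. if n < id c then h (id c) else K)"
  have "1 \<le> K" using h[of 1] n by auto
  then have "valid_problem ?I" using P n h[of 1] by (intro valid_chain_graph) auto
  then obtain S where "produces A ?I S" using A by (auto simp: online_algorithm_def)
  then show ?case by (intro exI[of _ id] exI[of _ S]) (auto simp: bij_betw_def)
next
  case (step s)
  define len where "len \<rho> s c = (if s < \<rho> c then h (\<rho> c) else K)" for \<rho> s and c :: nat
  obtain \<rho> S where \<rho>: "bij_betw \<rho> {1..n} {1..n}"
    and S: "produces A (chain_graph P n (len \<rho> (Suc s))) S"
    and ord: "\<And>c d. c \<in> {1..n} \<Longrightarrow> d \<in> {1..n} \<Longrightarrow> Suc s < \<rho> c \<Longrightarrow> \<rho> d < \<rho> c \<Longrightarrow>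
       finish S c (h (\<rho> c) - 1) \<le> finish S d (h (\<rho> c) - 1)"
    using step.IH unfolding len_def by blast
  have \<rho>_in: "\<rho> c \<in> {1..n}" if "c \<in> {1..n}" for c using \<rho> that by (auto simp: bij_betw_def)
  have K: "1 \<le> K" using h[of 1] n by auto
  define m where "m = h (Suc s)"
  have m: "1 \<le> m" "m \<le> K" using h[of "Suc s"] step by (auto simp: m_def)
  \<comment> \<open>The chains in \<open>U\<close> still have length \<open>K\<close>. The first of
    them to complete its \<open>m\<close>-th task is cut next.\<close>
  define U where "U = {c \<in> {1..n}. \<rho> c \<le> Suc s}"
  have "\<exists>c\<in>{1..n}. \<rho> c = Suc s" 
  proof -
    have "Suc s \<in> \<rho> ` {1..n}" using bij_betw_imp_surj_on[OF \<rho>] step.hyps by simp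
    then show ?thesis by (metis imageE)
  qed
  then have "U \<noteq> {}" "finite U" by (auto simp: U_def)
  then obtain c where c: "c \<in> U" and c_min: "\<And>d. d \<in> U \<Longrightarrow> finish S c (m - 1) \<le> finish S d (m - 1)"
    using arg_min_if_finite[of U "\<lambda>d. finish S d (m - 1)"] by (meson not_le_imp_less)
  have c_in: "c \<in> {1..n}" "\<rho> c \<le> Suc s" using c by (auto simp: U_def)
  \<comment> \<open>Exchanging two ranks gives \<open>c\<close> the rank \<open>Suc s\<close> and
    leaves all ranks above \<open>Suc s\<close> untouched.\<close>
  define \<rho>' where "\<rho>' = Transposition.transpose (Suc s) (\<rho> c) \<circ> \<rho>"
  have "bij_betw (Transposition.transpose (Suc s) (\<rho> c)) {1..n} {1..n}"
    using \<rho>_in[OF c_in(1)] step.hyps by (intro bij_betw_transpose_iff) simp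
  with \<rho> have \<rho>': "bij_betw \<rho>' {1..n} {1..n}" unfolding \<rho>'_def by (rule bij_betw_trans)
  have \<rho>'_c: "\<rho>' c = Suc s" by (simp add: \<rho>'_def)
  have above: "\<rho>' d = \<rho> d" if "Suc s < \<rho> d \<or> Suc s < \<rho>' d" for d
    using that c_in by (auto simp: \<rho>'_def Transposition.transpose_def split: if_splits)
  have \<rho>'_eq: "d = c" if "\<rho>' d = Suc s" "d \<in> {1..n}" for d
    using inj_onD[OF bij_betw_imp_inj_on[OF \<rho>'], of d c] \<rho>'_c that c_in by simp
  have len_eq: "len \<rho>' s d = ((len \<rho> (Suc s))(c := m)) d" if "d \<in> {1..n}" for d
  proof (cases "d = c")
    case True
    then show ?thesis using \<rho>'_c by (simp add: len_def m_def)
  next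
    case False
    then have ne: "\<rho>' d \<noteq> Suc s" using \<rho>'_eq that by blast
    show ?thesis
    proof (cases "Suc s < \<rho> d")
      case True
      with False above[of d] show ?thesis by (simp add: len_def)
    next
      case le: False
      then have "\<not> Suc s < \<rho>' d" using above[of d] by linarith
      with False le ne show ?thesis by (simp add: len_def)
    qed
  qed
  have I_eq: "chain_graph P n (len \<rho>' s) = chain_graph P n ((len \<rho> (Suc s))(c := m))"
    using len_eq by (rule chain_graph_cong)
  have len1: "1 \<le> len \<rho> (Suc s) d" if "d \<in> {1..n}" for d
    using h[OF \<rho>_in[OF that]] K by (simp add: len_def)
  have feas: "feasible (chain_graph P n (len \<rho> (Suc s))) S" using S by (simp add: produces_def)
  have "valid_problem (chain_graph P n (len \<rho>' s))" using P n len1[of 1] len_eq[of 1] m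
    by (intro valid_chain_graph) auto
  then obtain S' where S': "produces A (chain_graph P n (len \<rho>' s)) S'"
    using A by (auto simp: online_algorithm_def)
  have len_c: "len \<rho> (Suc s) c = K" using c_in by (simp add: len_def)
  have agree: "finish S' d i = finish S d i"
    if "d \<in> {1..n}" "i < len \<rho>' s d"
      "finish S d i \<le> finish S c (m - 1) \<or> finish S' d i \<le> finish S c (m - 1)" for d i
    using produces_chain_graph_cut[OF S S'[unfolded I_eq] P len1 c_in(1) m(1) _ that(1) _ that(3)]
      that(2) m(2) len_eq[OF that(1)] len_c by simp
  have "finish S' a (h (\<rho>' a) - 1) \<le> finish S' d (h (\<rho>' a) - 1)"
    if a: "a \<in> {1..n}" "s < \<rho>' a" and d: "d \<in> {1..n}" "\<rho>' d < \<rho>' a" for a d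
  proof -
    define i where "i = h (\<rho>' a) - 1"
    have \<rho>'_in: "\<rho>' x \<in> {1..n}" if "x \<in> {1..n}" for x using \<rho>' that by (auto simp: bij_betw_def)
    have "h (\<rho>' a) \<le> h (\<rho>' d)" using anti \<rho>'_in[OF a(1)] \<rho>'_in[OF d(1)] d(2) by simp
    then have i: "i < len \<rho>' s a" "i < len \<rho>' s d"
      using h[OF \<rho>'_in[OF a(1)]] a by (auto simp: len_def i_def)
    show ?thesis
    proof (cases "\<rho>' a = Suc s")
      case True
      then have ac: "a = c" "i = m - 1" using \<rho>'_eq a by (auto simp: i_def m_def)
      have "finish S' c i = finish S c i" using agree[OF a(1) i(1)] ac by simp
      \<comment> \<open>Otherwise \<open>d\<close> would finish before the cut in \<open>S'\<close>,
        hence at the same time in \<open>S\<close>, against the choice of \<open>c\<close>.\<close>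
      moreover have "finish S c i \<le> finish S' d i"
      proof (rule ccontr)
        assume "\<not> finish S c i \<le> finish S' d i"
        with agree[OF d(1) i(2)] ac have "finish S d i < finish S c i" by simp
        moreover have "d \<in> U" using d True above[of d] by (force simp: U_def)
        ultimately show False using c_min[of d] ac by simp
      qed
      ultimately show ?thesis using ac i_def by simp
    next
      case False
      then have ra: "Suc s < \<rho> a" "\<rho>' a = \<rho> a" using a above[of a] by auto
      have rd: "\<rho> d < \<rho> a" using d ra above[of d] by (cases "Suc s < \<rho> d") auto
      \<comment> \<open>Chain \<open>a\<close> was cut in an earlier round and ends no later than
        \<open>c\<close> now does, so its end is unaffected by the new cut.\<close>
      have "finish S a i \<le> finish S c i" using ord[OF a(1) c_in(1) ra(1)] ra c_in by (simp add: i_def)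
      also have "\<dots> \<le> finish S c (m - 1)"
      proof (rule finish_mono[OF feas c_in(1)])
        show "i \<le> m - 1" using anti[of "Suc s" "\<rho> a"] ra \<rho>_in[OF a(1)] by (simp add: i_def m_def)
        show "m - 1 < len \<rho> (Suc s) c" using m len_c by simp
      qed
      finally have le: "finish S a i \<le> finish S c (m - 1)" .
      then have eq: "finish S' a i = finish S a i" using agree[OF a(1) i(1)] by simp
      have "finish S a i \<le> finish S d i" using ord[OF a(1) d(1) ra(1) rd] ra by (simp add: i_def)
      \<comment> \<open>Either \<open>d\<close> completes this task by the new cut and the old
        comparison carries over, or it does so later, hence after \<open>a\<close>.\<close>
      then have "finish S' a i \<le> finish S' d i"
        using agree[OF d(1) i(2)] le eq by (cases "finish S' d i \<le> finish S c (m - 1)") auto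
      then show ?thesis by (simp add: i_def)
    qed
  qed
  with \<rho>' S' show ?case unfolding len_def by blast
qed

section \<open>Lower bound on the makespan\<close>

text \<open>
  If the group took less time, each of its tasks would use at least \<open>2 ^ (L + m)\<close> processors; the
  work \<open>p / (\<lfloor>log\<^sub>2 p\<rfloor> + 1)\<close> of such a task is so large that the whole group exceeds the capacity.
\<close>

lemma group_delay:
  assumes feas: "feasible (chain_graph (2 ^ (L + K - 1)) n len) S"
    and card: "card {c \<in> {1..n}. len c = m} = 2 ^ (K - m)" and m: "1 \<le> m" "m \<le> K" and L: "1 \<le> L"
    and a: "\<And>c. c \<in> {1..n} \<Longrightarrow> len c = m \<Longrightarrow> a \<le> start S (task c (m - 1))"
  shows "\<exists>c\<in>{1..n}. len c = m \<and> a + 1 / real (L + m) \<le> finish S c (m - 1)"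
proof (rule ccontr)
  assume "\<not> ?thesis"
  then have fin: "finish S c (m - 1) < a + 1 / real (L + m)" if "c \<in> {1..n}" "len c = m" for c
    using that by force
  let ?I = "chain_graph (2 ^ (L + K - 1)) n len"
  define G where "G = {c \<in> {1..n}. len c = m}"
  define t where "t c = task c (m - 1)" for c
  have inj: "inj_on t G" by (auto simp: inj_on_def t_def)
  \<comment> \<open>The work of \<open>2 ^ (L + m)\<close> processors during time
    \<open>1 / (L + m + 1)\<close>, a lower bound for each last task of the group.\<close>
  define w where "w = 2 ^ (L + m) / real (L + m + 1)"
  have work: "w \<le> real (alloc S (t c)) * (finish S c (m - 1) - start S (t c))" if "c \<in> G" for c
  proof -
    define p where "p = alloc S (t c)"
    define k where "k = floor_log p"
    have c: "c \<in> {1..n}" "len c = m" using that by (auto simp: G_def)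
    have "t c \<in> tasks ?I" using c m by (simp add: t_def)
    then have p: "1 \<le> p" using feas by (auto simp: feasible_def p_def)
    have dur: "finish S c (m - 1) - start S (t c) = 1 / real (Suc k)"
      by (simp add: finish_def k_def p_def t_def)
    with fin[OF c] a[OF c] have "1 / real (Suc k) < 1 / real (L + m)" by (simp add: t_def)
    then have "L + m \<le> k" using m by (simp add: field_simps del: of_nat_Suc of_nat_add)
    \<comment> \<open>The quotient \<open>2 ^ k / (k + 1)\<close> is nondecreasing in
      \<open>k\<close>, so \<open>k = L + m\<close> is the least case.\<close>
    then have "w \<le> 2 ^ k / real (k + 1)"
      unfolding w_def
    proof (induction k rule: dec_induct)
      case (step k)
      have "(2::real) ^ k / real (k + 1) \<le> 2 ^ Suc k / real (Suc k + 1)" by (simp add: field_simps)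
      with step show ?case by linarith
    qed simp
    also have "\<dots> \<le> real p * (1 / real (Suc k))"
    proof -
      have "2 ^ k \<le> p" using floor_log_exp2_le[of p] p by (simp add: k_def)
      then have "(2::real) ^ k \<le> real p" by (metis of_nat_le_iff of_nat_numeral of_nat_power)
      then show ?thesis by (simp add: divide_right_mono)
    qed
    finally show ?thesis by (simp only: dur p_def)
  qed
  have "real (2 ^ (K - m)) * w \<le> (\<Sum>c\<in>G. real (alloc S (t c)) * (finish S c (m - 1) - start S (t c)))"
    using sum_mono[of G "\<lambda>_. w", OF work] card by (simp add: G_def)
  also have "\<dots> = (\<Sum>j\<in>t ` G. real (alloc S j) * (completion ?I S j - start S j))"
    by (subst sum.reindex[OF inj]) (simp add: t_def)
  also have "\<dots> \<le> real (procs ?I) * (a + 1 / real (L + m) - a)"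
  proof (rule window_area[OF feas])
    show "t ` G \<subseteq> tasks ?I" using m by (auto simp: G_def t_def)
    show "a \<le> start S j \<and> start S j \<le> completion ?I S j \<and> completion ?I S j \<le> a + 1 / real (L + m)"
      if "j \<in> t ` G" for j
    proof -
      from that obtain c where "c \<in> {1..n}" "len c = m" "j = task c (m - 1)"
        by (auto simp: G_def t_def)
      with a[of c] fin[of c] start_less_finish[of S c "m - 1"] show ?thesis by simp
    qed
  qed auto
  also have "\<dots> = 2 ^ (L + K - 1) / real (L + m)" by simp
  finally have "2 ^ (K - m) * w \<le> 2 ^ (L + K - 1) / real (L + m)" by simp
  \<comment> \<open>Written this way, both sides share the factor \<open>2 ^ (L + K - 1)\<close>.
    What remains is \<open>2 * (L + m) \<le> L + m + 1\<close>, which fails because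
    \<open>L + m\<close> is at least 2.\<close>
  moreover have "2 ^ (K - m) * w = 2 * 2 ^ (L + K - 1) / real (L + m + 1)"
  proof -
    have "(2::real) ^ (K - m) * 2 ^ (L + m) = 2 ^ (Suc (L + K - 1))"
      using m by (subst power_add[symmetric]) (rule arg_cong[of _ _ "(^) 2"], simp)
    then show ?thesis by (simp add: w_def)
  qed
  ultimately have "2 ^ (L + K - 1) * (2 / real (L + m + 1)) \<le> 2 ^ (L + K - 1) * (1 / real (L + m))"
    by (simp add: mult.commute)
  then have "2 / real (L + m + 1) \<le> 1 / real (L + m)" by (subst (asm) mult_le_cancel_left_pos) auto
  then have "2 * real (L + m) \<le> real (L + m + 1)" using m by (simp add: field_simps)
  with m L show False by simp
qed

text \<open>By \<open>ord\<close>, the chains of length \<open>Suc m\<close> complete their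
  \<open>m\<close>-th tasks no earlier than any chain of length \<open>m\<close> ends. So all last
  tasks of the next group start after the time reached so far, and \<open>group_delay\<close> adds
  the next summand.\<close>

lemma chain_delay:
  assumes feas: "feasible (chain_graph (2 ^ (L + K - 1)) n len) S"
    and card: "\<And>m. m \<in> {1..K} \<Longrightarrow> card {c \<in> {1..n}. len c = m} = 2 ^ (K - m)" and L: "1 \<le> L"
    and ord: "\<And>c d. c \<in> {1..n} \<Longrightarrow> d \<in> {1..n} \<Longrightarrow> len c < len d \<Longrightarrow>
       finish S c (len c - 1) \<le> finish S d (len c - 1)"
    and m: "1 \<le> m" "m \<le> K"
  shows "\<exists>c\<in>{1..n}. len c = m \<and> (\<Sum>i = 1..m. 1 / real (L + i)) \<le> finish S c (m - 1)"
  using m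
proof (induction m rule: dec_induct)
  let ?I = "chain_graph (2 ^ (L + K - 1)) n len"
  case base
  have "0 \<le> start S (task c (1 - 1))" if "c \<in> {1..n}" "len c = 1" for c
  proof -
    have "task c 0 \<in> tasks ?I" using that by simp
    then show ?thesis using feas unfolding feasible_def by auto
  qed
  from group_delay[OF feas card _ base L this] base show ?case by simp
next
  let ?I = "chain_graph (2 ^ (L + K - 1)) n len"
  case (step m)
  define a where "a = (\<Sum>i = 1..m. 1 / real (L + i))"
  obtain c where c: "c \<in> {1..n}" "len c = m" "a \<le> finish S c (m - 1)"
    using step by (auto simp: a_def)
  have "a \<le> start S (task d (Suc m - 1))" if d: "d \<in> {1..n}" "len d = Suc m" for d
  proof -
    have "(task d (m - 1), task d m) \<in> edges ?I" using d step by simp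
    then have "completion ?I S (task d (m - 1)) \<le> start S (task d m)"
      using feas unfolding feasible_def by blast
    then show ?thesis using ord[OF c(1) d(1)] c d by simp
  qed
  then have "\<exists>d\<in>{1..n}. len d = Suc m \<and> a + 1 / real (L + Suc m) \<le> finish S d (Suc m - 1)"
    using step.prems L by (intro group_delay[OF feas card]) auto
  then show ?case by (simp add: a_def algebra_simps)
qed

section \<open>Estimates and choice of parameters\<close>

text \<open>Telescoping of \<open>ln (x + 1) - ln x \<le> 1 / x\<close> over
  \<open>x = L + 1, ..., L + K\<close>.\<close>

lemma sum_inverse_ge_ln:
  fixes L :: nat
  assumes "1 \<le> L"
  shows "ln (real (L + K + 1) / real (L + 1)) \<le> (\<Sum>i = 1..K. 1 / real (L + i))"
proof (induction K)
  case (Suc K)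
  have "ln (real (L + Suc K + 1)) - ln (real (L + K + 1)) \<le> 1 / real (L + K + 1)"
    using ln_diff_le[of "real (L + Suc K + 1)" "real (L + K + 1)"] by simp
  with Suc assms show ?case by (simp add: ln_div algebra_simps)
qed simp

text \<open>Serves to show that \<open>D\<close> is at most \<open>2 ^ L\<close> for
  \<open>L = floor_sqrt D - 1\<close>, so that the offline schedule has enough processors.\<close>

lemma square_le_two_power: "8 \<le> q \<Longrightarrow> (q + 1)\<^sup>2 \<le> 2 ^ (q - 1)" for q :: nat
proof (induction q rule: dec_induct)
  case (step q)
  have "(Suc q + 1)\<^sup>2 \<le> 2 * (q + 1)\<^sup>2"
  proof -
    have "8 * 8 \<le> q * q" using step.hyps(1) by (intro mult_le_mono)
    then show ?thesis by (simp add: power2_eq_square algebra_simps)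
  qed
  also have "\<dots> \<le> 2 * 2 ^ (q - 1)" using step by simp
  also have "\<dots> = 2 ^ (Suc q - 1)" using step.hyps by (cases q) auto
  finally show ?case .
qed simp

lemma floor_log_eq_iff:
  assumes "0 < r"
  shows "floor_log r = k \<longleftrightarrow> 2 ^ k \<le> r \<and> r < 2 ^ Suc k"
proof
  assume "floor_log r = k"
  then show "2 ^ k \<le> r \<and> r < 2 ^ Suc k"
    using floor_log_exp2_le[OF assms] floor_log_exp2_gt[of r] by simp
next
  assume "2 ^ k \<le> r \<and> r < 2 ^ Suc k"
  then show "floor_log r = k" using assms by (intro floor_log_eqI) auto
qed

text \<open>Length \<open>m\<close> belongs to the ranks with \<open>K - m + 1\<close> binary
  digits, of which there are \<open>2 ^ (K - m)\<close>. Shorter chains thus get larger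
  ranks.\<close>

lemma card_length_class:
  fixes K m :: nat
  assumes m: "m \<in> {1..K}"
  shows "card {r \<in> {1..2 ^ K - 1}. K - floor_log r = m} = 2 ^ (K - m)"
proof -
  have "{r \<in> {1..2 ^ K - 1}. K - floor_log r = m} = {2 ^ (K - m)..<2 ^ Suc (K - m)}"
  proof (intro set_eqI iffI)
    fix r assume "r \<in> {r \<in> {1..2 ^ K - 1}. K - floor_log r = m}"
    then have "0 < r" "floor_log r = K - m" using m by auto
    then show "r \<in> {2 ^ (K - m)..<2 ^ Suc (K - m)}" by (simp add: floor_log_eq_iff)
  next
    fix r :: nat assume r: "r \<in> {2 ^ (K - m)..<2 ^ Suc (K - m)}"
    then have r0: "0 < r" by (auto intro: Suc_le_lessD order.trans[rotated])
    then have "floor_log r = K - m" using r by (simp add: floor_log_eq_iff)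
    moreover have "(2::nat) ^ Suc (K - m) \<le> 2 ^ K" using m by (intro power_increasing) auto
    then have "r < 2 ^ K" using r by simp
    ultimately show "r \<in> {r \<in> {1..2 ^ K - 1}. K - floor_log r = m}" using r0 m by auto
  qed
  then show ?thesis by simp
qed

theorem theorem7:
  shows "\<exists>c::real. c > 0 \<and> (\<exists>D0::nat. \<forall>A. online_algorithm A \<longrightarrow>
           (\<forall>D\<ge>D0. \<exists>I S. valid_problem I \<and> longest_path I = D \<and> produces A I S \<and>
              makespan I S \<ge> c * ln (real D) * opt_makespan I))"
proof (intro exI[of _ "1 / 2 :: real"] exI[of _ "64 :: nat"] conjI allI impI)
  fix A and D :: nat
  assume A: "online_algorithm A" and D: "64 \<le> D"
  \<comment> \<open>\<open>L + 1\<close> must be at most the square root of \<open>D\<close> to keep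
    half of the logarithm, while \<open>D\<close> must be at most \<open>2 ^ L\<close> for the
    offline schedule. The threshold 64 gives \<open>8 \<le> q\<close>, which yields the second
    bound.\<close>
  define q where "q = floor_sqrt D"
  define L where "L = q - 1"
  have "8 \<le> q" using D by (simp add: q_def le_floor_sqrt_iff)
  then have L: "1 \<le> L" "q = L + 1" by (auto simp: L_def)
  have LD: "(L + 1)\<^sup>2 \<le> D" using floor_sqrt_power2_le[of D] L(2) unfolding q_def by metis
  have "D < (q + 1)\<^sup>2" using Suc_floor_sqrt_power2_gt[of D] by (simp add: q_def)
  then have DL: "D \<le> 2 ^ L" using square_le_two_power[OF \<open>8 \<le> q\<close>] by (simp add: L_def)
  define n :: nat where "n = 2 ^ D - 1"
  define P :: nat where "P = 2 ^ (L + D - 1)"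
  define h where "h r = D - floor_log r" for r
  have "(2::nat) ^ 1 \<le> 2 ^ D" using D by (intro power_increasing) auto
  then have n: "1 \<le> n" by (simp add: n_def)
  have P: "1 \<le> P" by (simp add: P_def)
  have h: "1 \<le> h r \<and> h r \<le> D" if "r \<in> {1..n}" for r
  proof -
    have "2 ^ floor_log r \<le> r" using that by (intro floor_log_exp2_le) auto
    also have "r < 2 ^ D" using that by (auto simp: n_def)
    finally have "floor_log r < D" by simp
    then show ?thesis by (simp add: h_def)
  qed
  have anti: "h s \<le> h r" if "r \<le> s" for r s
    using floor_log_le_iff[OF that] by (simp add: h_def)
  \<comment> \<open>With \<open>s = 0\<close> all chains have been cut, because ranks are at least
    1.\<close>
  obtain \<rho> S where \<rho>: "bij_betw \<rho> {1..n} {1..n}"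
    and S: "produces A (chain_graph P n (\<lambda>c. if 0 < \<rho> c then h (\<rho> c) else D)) S"
    and ord: "\<And>c d. c \<in> {1..n} \<Longrightarrow> d \<in> {1..n} \<Longrightarrow> 0 < \<rho> c \<Longrightarrow> \<rho> d < \<rho> c \<Longrightarrow>
       finish S c (h (\<rho> c) - 1) \<le> finish S d (h (\<rho> c) - 1)"
    using adversary[of A P n h D 0] A P n h anti by blast
  have \<rho>_in: "\<rho> c \<in> {1..n}" if "c \<in> {1..n}" for c using \<rho> that by (auto simp: bij_betw_def)
  define len where "len c = h (\<rho> c)" for c
  define I where "I = chain_graph P n len"
  have "I = chain_graph P n (\<lambda>c. if 0 < \<rho> c then h (\<rho> c) else D)"
    unfolding I_def using \<rho>_in by (intro chain_graph_cong) (force simp: len_def)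
  with S have S: "produces A I S" by simp
  then have feas: "feasible I S" by (simp add: produces_def)
  have len: "1 \<le> len c" "len c \<le> D" if "c \<in> {1..n}" for c using h[OF \<rho>_in[OF that]] by (auto simp: len_def)
  have card: "card {c \<in> {1..n}. len c = m} = 2 ^ (D - m)" if m: "m \<in> {1..D}" for m
  proof -
    have "inj_on \<rho> {c \<in> {1..n}. len c = m}"
      using \<rho> by (auto simp: bij_betw_def intro: inj_on_subset)
    then have "card {c \<in> {1..n}. len c = m} = card (\<rho> ` {c \<in> {1..n}. h (\<rho> c) = m})"
      by (simp add: card_image len_def)
    also have "\<rho> ` {c \<in> {1..n}. h (\<rho> c) = m} = {r \<in> \<rho> ` {1..n}. h r = m}" by blast
    also have "\<dots> = {r \<in> {1..2 ^ D - 1}. D - floor_log r = m}"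
      using bij_betw_imp_surj_on[OF \<rho>] by (simp add: h_def n_def)
    finally show ?thesis using card_length_class[OF m] by simp
  qed
  have "finish S c (len c - 1) \<le> finish S d (len c - 1)"
    if "c \<in> {1..n}" "d \<in> {1..n}" "len c < len d" for c d
  proof -
    \<comment> \<open>\<open>h\<close> is antitone, so the strictly shorter chain has the strictly
      larger rank.\<close>
    have "\<rho> d < \<rho> c" using anti[of "\<rho> c" "\<rho> d"] that(3) by (force simp: len_def)
    then show ?thesis using ord[OF that(1,2)] by (simp add: len_def)
  qed
  from chain_delay[OF feas[unfolded I_def P_def] card L(1) this, of D] D
  obtain c where c: "c \<in> {1..n}" "len c = D" "(\<Sum>i = 1..D. 1 / real (L + i)) \<le> finish S c (D - 1)"
    by auto
  have "valid_problem I" unfolding I_def using P n len by (intro valid_chain_graph) auto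
  moreover have "longest_path I = D"
    unfolding I_def using D len by (intro longest_path_chain_graph[where c = c] c) auto
  moreover have "1 / 2 * ln (real D) * opt_makespan I \<le> makespan I S"
  proof -
    \<comment> \<open>Every one of the \<open>D\<close> groups takes
      \<open>2 ^ (D - m) * 2 ^ (m - 1)\<close> processors offline, which is
      \<open>2 ^ (D - 1)\<close> for each \<open>m\<close>.\<close>
    have "(\<Sum>c = 1..n. 2 ^ (len c - 1)) = (\<Sum>m = 1..D. \<Sum>c\<in>{c \<in> {1..n}. len c = m}. 2 ^ (len c - 1) :: nat)"
      using len by (intro sum.group[symmetric]) auto
    also have "\<dots> = (\<Sum>m = 1..D. 2 ^ (D - 1))"
    proof (rule sum.cong[OF refl])
      fix m assume m: "m \<in> {1..D}"
      have "(\<Sum>c\<in>{c \<in> {1..n}. len c = m}. 2 ^ (len c - 1) :: nat) = 2 ^ (D - m) * 2 ^ (m - 1)"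
        using card[OF m] by simp
      also have "\<dots> = 2 ^ (D - 1)" using m by (simp flip: power_add)
      finally show "(\<Sum>c\<in>{c \<in> {1..n}. len c = m}. 2 ^ (len c - 1) :: nat) = 2 ^ (D - 1)" .
    qed
    also have "\<dots> \<le> 2 ^ L * 2 ^ (D - 1)" using DL by simp
    also have "\<dots> = P" using D by (simp add: P_def flip: power_add)
    finally have "opt_makespan I \<le> 1"
      unfolding I_def using len n by (intro opt_makespan_chain_graph) auto
    then have "1 / 2 * ln (real D) * opt_makespan I \<le> 1 / 2 * ln (real D)"
      using D by (intro mult_left_le) auto
    \<comment> \<open>Since \<open>(L + 1)\<^sup>2\<close> is at most \<open>D\<close>, the
      denominator costs at most half of \<open>ln D\<close>; hence the constant 1/2.\<close>
    also have "\<dots> \<le> ln (real (L + D + 1) / real (L + 1))"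
    proof -
      have "2 * ln (real (L + 1)) = ln (real ((L + 1)\<^sup>2))" by (simp add: ln_realpow)
      also have "\<dots> \<le> ln (real D)" using LD D by (subst ln_le_cancel_iff) (auto simp del: of_nat_power)
      finally have "2 * ln (real (L + 1)) \<le> ln (real D)" .
      moreover have "ln (real D) \<le> ln (real (L + D + 1))" using D by simp
      ultimately show ?thesis by (simp add: ln_div del: of_nat_add)
    qed
    also have "\<dots> \<le> (\<Sum>i = 1..D. 1 / real (L + i))" by (rule sum_inverse_ge_ln[OF L(1)])
    also have "\<dots> \<le> completion I S (task c (D - 1))" using c by (simp add: I_def)
    also have "\<dots> \<le> makespan I S"
      unfolding makespan_def using c D by (intro Max_ge imageI) (auto simp: I_def)
    finally show ?thesis .
  qed
  ultimately show "\<exists>I S. valid_problem I \<and> longest_path I = D \<and> produces A I S \<and>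
      1 / 2 * ln (real D) * opt_makespan I \<le> makespan I S"
    using S by blast
qed simp

end
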